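(* (a) Every ecumenical formula all of whose subformulas (including itself) carry the superscript $i$ is monotonic. (b) For every $p\in\mathsf{At}$, the formula $p^c$ is not monotonic.
   Context: Basic setting. Let $\mathsf{At}$ be a countably infinite set of atomic propositions and $\mathsf{At}_\bot=\mathsf{At}\cup\{\bot\}$. An atomic rule has the form "from premises $p_1,\dots,p_n$ ($n\ge 0$) infer $p$", with $p_j,p\in\mathsf{At}_\bot$, where the derivation of each premise may discharge a set of basic sentences. An atomic system $S$ is a set of atomic rules; $S\subseteq S'$ ($S'$ extends $S$) if $S'$ contains all rules of $S$. $\Delta\vdash_S p$ means there is a natural-deduction derivation using only rules of $S$ with conclusion $p$ and undischarged assumptions in $\Delta$ (so $p\vdash_S p$). $S$ is consistent if $\nvdash_S\bot$. Standing convention: all atomic systems (including all extensions quantified over) are required to be consistent. Ecumenical formulas: $p^i,p^c$ for $p\in\mathsf{At}_\bot$; $(A\wedge B)^x,(A\vee B)^x,(A\to B)^x$ for $x\in\{i,c\}$. $A\wedge B$, $A\vee B$, $A\to B$ abbreviate the $i$-versions, $\bot$ denotes $\bot^i$, $\neg A:=(A\to\bot^i)^i$; for $X^c$, $X^i$ is the same construction with outer superscript $i$. Weak validity (by simultaneous recursion): (1) $\Vdash^L_S p^i$ iff $\vdash_S p$ ($p\in\mathsf{At}_\bot$); (2) $\Vdash^L_S p^c$ iff $p\nvdash_S\bot$; (3) for non-atomic $X$, $\Vdash^L_S X^c$ iff $X^i\nVdash^L_S\bot$; (4) $\Vdash^L_S(A\wedge B)^i$ iff $\Vdash^L_S A$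 and $\Vdash^L_S B$; (5) $\Vdash^L_S(A\to B)^i$ iff $A\Vdash^G_S B$; (6) $\Vdash^L_S(A\vee B)^i$ iff for all $S'\supseteq S$ and all $p\in\mathsf{At}_\bot$, if $A\Vdash^L_{S'}p^i$ and $B\Vdash^L_{S'}p^i$ then $\Vdash^L_{S'}p^i$; (7) for nonempty $\Gamma$, $\Gamma\Vdash^L_S A$ iff for all $S'\supseteq S$, if $\Vdash^L_{S'}B$ for all $B\in\Gamma$ then $\Vdash^L_{S'}A$; (8) $\Gamma\Vdash^G_S A$ iff for all $S'\supseteq S$: if $\Vdash^L_{S''}B$ for all $B\in\Gamma$ and all $S''\supseteq S'$, then $\Vdash^L_{S''}A$ for all $S''\supseteq S'$. A formula $A$ is $S$-monotonic if for all $S'\supseteq S$, $\Vdash^L_S A$ implies $\Vdash^L_{S'}A$; $A$ is monotonic if it is $S$-monotonic for every atomic system $S$. *)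

theory Defs
  imports "HOL-Library.Countable_Set"
begin

text \<open>The type \<open>'a\<close> is the set of atomic propositions; \<open>'a basic\<close> is that set with bottom added.\<close>

datatype 'a basic = At 'a | Bot

text \<open>A rule is a list of premises, each paired with the set of basic sentences that may be
  discharged in its derivation, together with a conclusion.\<close>

datatype 'a rule = Rule (prems_of: "('a basic set \<times> 'a basic) list") (concl_of: "'a basic")

type_synonym 'a system = "'a rule set"

text \<open>Natural deduction with the undischarged assumptions recorded as a context: above a premise,
  the sentences discharged there are additionally available.\<close>

inductive deducible :: "'a system \<Rightarrow> 'a basic set \<Rightarrow> 'a basic \<Rightarrow> bool" for S where
  assumption: "p \<in> \<Delta> \<Longrightarrow> deducible S \<Delta> p"
| rule: "\<lbrakk>r \<in> S; \<And>D q. (D, q) \<in> set (prems_of r) \<Longrightarrow> deducible S (\<Delta> \<union> D) q\<rbrakk>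
    \<Longrightarrow> deducible S \<Delta> (concl_of r)"

definition consistent :: "'a system \<Rightarrow> bool" where
  "consistent S \<longleftrightarrow> \<not> deducible S {} Bot"

text \<open>Only consistent extensions are ever quantified over.\<close>

definition extensions :: "'a system \<Rightarrow> 'a system set" where
  "extensions S = {S'. S \<subseteq> S' \<and> consistent S'}"

datatype superscript = Intu | Clas

datatype 'a form =
    Atom "'a basic" (sup_of: superscript)
  | Conj "'a form" "'a form" (sup_of: superscript)
  | Disj "'a form" "'a form" (sup_of: superscript)
  | Impl "'a form" "'a form" (sup_of: superscript)

primrec subformulas :: "'a form \<Rightarrow> 'a form set" where
  "subformulas (Atom p x) = {Atom p x}"
| "subformulas (Conj A B x) = insert (Conj A B x) (subformulas A \<union> subformulas B)"
| "subformulas (Disj A B x) = insert (Disj A B x) (subformulas A \<union> subformulas B)"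
| "subformulas (Impl A B x) = insert (Impl A B x) (subformulas A \<union> subformulas B)"

text \<open>The local and global consequence relations are parametrised by the validity predicate
  \<open>V\<close>, so that they can be used inside its recursive definition; the relations of the
  semantics are the instances with \<open>V = valid\<close>.\<close>

definition local_conseq ::
  "('a system \<Rightarrow> 'a form \<Rightarrow> bool) \<Rightarrow> 'a system \<Rightarrow> 'a form set \<Rightarrow> 'a form \<Rightarrow> bool" where
  "local_conseq V S \<Gamma> A \<longleftrightarrow>
    (if \<Gamma> = {} then V S A
     else \<forall>S'\<in>extensions S. (\<forall>B\<in>\<Gamma>. V S' B) \<longrightarrow> V S' A)"

definition global_conseq ::
  "('a system \<Rightarrow> 'a form \<Rightarrow> bool) \<Rightarrow> 'a system \<Rightarrow> 'a form set \<Rightarrow> 'a form \<Rightarrow> bool" where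
  "global_conseq V S \<Gamma> A \<longleftrightarrow>
    (\<forall>S'\<in>extensions S.
       (\<forall>B\<in>\<Gamma>. \<forall>S''\<in>extensions S'. V S'' B) \<longrightarrow> (\<forall>S''\<in>extensions S'. V S'' A))"

lemma local_conseq_cong [fundef_cong]:
  assumes "S = S'" "\<Gamma> = \<Gamma>'" "A = A'"
    and "\<And>T B. B \<in> insert A' \<Gamma>' \<Longrightarrow> V T B = V' T B"
  shows "local_conseq V S \<Gamma> A = local_conseq V' S' \<Gamma>' A'"
  using assms by (simp add: local_conseq_def)

lemma global_conseq_cong [fundef_cong]:
  assumes "S = S'" "\<Gamma> = \<Gamma>'" "A = A'"
    and "\<And>T B. B \<in> insert A' \<Gamma>' \<Longrightarrow> V T B = V' T B"
  shows "global_conseq V S \<Gamma> A = global_conseq V' S' \<Gamma>' A'"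
  using assms by (simp add: global_conseq_def)

text \<open>Termination measure: a classical formula must exceed its intuitionistic version, and every
  compound formula must exceed every intuitionistic atom.\<close>

primrec rank :: "'a form \<Rightarrow> nat" where
  "rank (Atom p x) = 0"
| "rank (Conj A B x) = rank A + rank B + (case x of Intu \<Rightarrow> 1 | Clas \<Rightarrow> 2)"
| "rank (Disj A B x) = rank A + rank B + (case x of Intu \<Rightarrow> 1 | Clas \<Rightarrow> 2)"
| "rank (Impl A B x) = rank A + rank B + (case x of Intu \<Rightarrow> 1 | Clas \<Rightarrow> 2)"

function valid :: "'a system \<Rightarrow> 'a form \<Rightarrow> bool" where
  "valid S (Atom p Intu) \<longleftrightarrow> deducible S {} p"
| "valid S (Atom p Clas) \<longleftrightarrow> \<not> deducible S {p} Bot"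
| "valid S (Conj A B Clas) \<longleftrightarrow> \<not> local_conseq valid S {Conj A B Intu} (Atom Bot Intu)"
| "valid S (Disj A B Clas) \<longleftrightarrow> \<not> local_conseq valid S {Disj A B Intu} (Atom Bot Intu)"
| "valid S (Impl A B Clas) \<longleftrightarrow> \<not> local_conseq valid S {Impl A B Intu} (Atom Bot Intu)"
| "valid S (Conj A B Intu) \<longleftrightarrow> valid S A \<and> valid S B"
| "valid S (Impl A B Intu) \<longleftrightarrow> global_conseq valid S {A} B"
| "valid S (Disj A B Intu) \<longleftrightarrow>
    (\<forall>S'\<in>extensions S. \<forall>p.
       local_conseq valid S' {A} (Atom p Intu) \<and> local_conseq valid S' {B} (Atom p Intu)
       \<longrightarrow> valid S' (Atom p Intu))"
  by pat_completeness auto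
termination
  by (relation "measure (\<lambda>(S, A). rank A)") auto

definition monotonic_at :: "'a system \<Rightarrow> 'a form \<Rightarrow> bool" where
  "monotonic_at S A \<longleftrightarrow> (\<forall>S'\<in>extensions S. valid S A \<longrightarrow> valid S' A)"

definition monotonic :: "'a form \<Rightarrow> bool" where
  "monotonic A \<longleftrightarrow> (\<forall>S. consistent S \<longrightarrow> monotonic_at S A)"

end

theory Submission
  imports Defs
begin

text \<open>Implication and disjunction are interpreted by quantifying over all extensions, so
  monotonicity of intuitionistic formulas reduces to monotonicity of deducibility. The formula
  \<open>p\<^sup>c\<close> holds in the empty system, but fails in the system whose only rule infers \<open>\<bottom>\<close> from \<open>p\<close>;
  the latter is consistent because every closed derivation in it needs a smaller closed derivation.\<close>

lemma deducible_mono: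
  assumes "deducible S \<Delta> p" and "S \<subseteq> T"
  shows "deducible T \<Delta> p"
  using assms(1)
proof induction
  case (assumption p \<Delta>)
  then show ?case by (rule deducible.assumption)
next
  case (rule r \<Delta>)
  with assms(2) show ?case by (blast intro: deducible.rule)
qed

lemma extensions_subset: "T \<in> extensions S \<Longrightarrow> extensions T \<subseteq> extensions S"
  by (auto simp: extensions_def)

lemma valid_mono_intuitionistic:
  assumes "\<forall>B\<in>subformulas A. sup_of B = Intu"
    and "T \<in> extensions S" and "valid S A"
  shows "valid T A"
  using assms
proof (induction A)
  case (Atom p x)
  then show ?case by (auto simp: extensions_def intro: deducible_mono)
next
  case (Conj A B x)
  then show ?case by auto
next
  case (Disj A B x)
  \<comment> \<open>The clause at \<open>T\<close> is an instance of the clause at \<open>S\<close>,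
    as it quantifies over fewer systems.\<close>
  then show ?case using extensions_subset[of T S] by auto
next
  case (Impl A B x)
  then show ?case using extensions_subset[of T S] by (auto simp: global_conseq_def)
qed

lemma deducible_empty_system:
  assumes "deducible {} \<Delta> p"
  shows "p \<in> \<Delta>"
  using assms by induction auto

lemma no_closed_derivation_if_all_rules_have_nondischarging_premise:
  assumes "\<And>r. r \<in> S \<Longrightarrow> \<exists>q. ({}, q) \<in> set (prems_of r)"
  shows "\<not> deducible S {} p"
proof
  assume "deducible S {} p"
  then show False
  proof (induction "{} :: 'a basic set" p rule: deducible.induct)
    case (rule r)
    \<comment> \<open>Discharging \<open>{}\<close> leaves the context empty, so the induction
      hypothesis refutes that premise.\<close>
    then show ?case using assms by fastforce
  qed simp
qed

lemma not_monotonic_classical_atom: "\<not> monotonic (Atom (At p) Clas)"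
proof
  assume mono: "monotonic (Atom (At p) Clas)"
  define T where "T = {Rule [({}, At p)] Bot}"
  have "T \<in> extensions {}"
    unfolding extensions_def consistent_def T_def
    \<comment> \<open>\<open>rotated\<close> makes the assumed derivation of \<open>Bot\<close> the
      major premise.\<close>
    by (auto dest!: no_closed_derivation_if_all_rules_have_nondischarging_premise[THEN notE, rotated])
  moreover have "consistent ({} :: 'a system)"
    by (auto simp: consistent_def dest: deducible_empty_system)
  moreover have "valid {} (Atom (At p) Clas)"
    by (auto dest: deducible_empty_system)
  ultimately have "\<not> deducible T {At p} Bot"
    using mono by (auto simp: monotonic_def monotonic_at_def)
  \<comment> \<open>Writing \<open>Bot\<close> as a \<open>concl_of\<close> term lets
    \<open>deducible.rule\<close> unify.\<close>
  moreover have "deducible T {At p} (concl_of (Rule [({}, At p)] Bot))"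
    by (rule deducible.rule) (auto simp: T_def intro: deducible.assumption)
  ultimately show False by simp
qed

theorem theorem4:
  assumes "countable (UNIV :: 'a set)" and "infinite (UNIV :: 'a set)"
  shows "(\<forall>A :: 'a form. (\<forall>B\<in>subformulas A. sup_of B = Intu) \<longrightarrow> monotonic A) \<and>
         (\<forall>p :: 'a. \<not> monotonic (Atom (At p) Clas))"
  using valid_mono_intuitionistic not_monotonic_classical_atom
  by (auto simp: monotonic_def monotonic_at_def)

end
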